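(* For every integer $n>0$, $$\langle W|(D+E)^{n-1}|V\rangle=\frac{1}{(1-q)^n}\sum_{k=0}^n(-1)^k\left(\binom{2n}{n-k}-\binom{2n}{n-k-2}\right)\left(\sum_{i=0}^k q^{i(k+1-i)}\right).$$
   Context: Let $q$ be an indeterminate (scalar). Let $D,E$ be operators, $\langle W|$ a row vector and $|V\rangle$ a column vector such that $DE-qED=D+E$, $\langle W|E=\langle W|$, $D|V\rangle=|V\rangle$ and $\langle W|\,|V\rangle=1$. For each $m\ge 0$, using $DE=qED+D+E$, one can uniquely write $(D+E)^m=\sum_{i,j\ge0}n_{i,j}E^iD^j$ (normal form) with $n_{i,j}\in\mathbb{Z}[q]$, and $\langle W|(D+E)^m|V\rangle=\sum_{i,j\geq 0} n_{i,j}$, which is a polynomial in $\mathbb{Z}[q]$. Binomial coefficients $\binom{a}{b}$ with $b<0$ or $b>a$ are zero. *)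

theory Defs
  imports
    "HOL-Computational_Algebra.Polynomial"
    "HOL-Computational_Algebra.Fraction_Field"
    "HOL-Computational_Algebra.Formal_Power_Series"
begin

text \<open>
  The scalars form a field \<open>'k\<close> of characteristic zero. The indeterminate \<open>q\<close> is an element of
  \<open>'k\<close> that is transcendental over the rationals, so the subring generated by \<open>q\<close> is a copy of the
  polynomial ring in \<open>q\<close> over the integers and \<open>1 - q\<close> is invertible; the field of rational
  functions in \<open>q\<close> is an instance (see \<open>fract_indeterminate\<close> below). Operators are linear maps on
  a vector space of column vectors, and a row vector is a linear functional, so the scalar
  obtained from the row vector \<open>W\<close>, an operator \<open>X\<close> and the column vector \<open>V\<close> is \<open>W (X V)\<close>.
\<close>

locale matrix_ansatz = vector_space scale
  for scale :: "'k::field_char_0 \<Rightarrow> 'v::ab_group_add \<Rightarrow> 'v" (infixr "*s" 75) +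
  fixes q :: 'k
    and D E :: "'v \<Rightarrow> 'v"
    and W :: "'v \<Rightarrow> 'k"
    and V :: 'v
  assumes indeterminate: "\<not> algebraic q"
    and linear_D: "Vector_Spaces.linear scale scale D"
    and linear_E: "Vector_Spaces.linear scale scale E"
    and linear_W: "Vector_Spaces.linear scale (*) W"
    and commutation: "\<And>v. D (E v) - q *s E (D v) = D v + E v"
    and W_E: "\<And>v. W (E v) = W v"
    and D_V: "D V = V"
    and W_V: "W V = 1"

text \<open>The lower index is an integer, so that negative values are not truncated to zero.\<close>

definition binom :: "nat \<Rightarrow> int \<Rightarrow> nat" where
  "binom a b = (if b < 0 then 0 else a choose nat b)"


subsection \<open>The hypotheses are satisfiable\<close>

instance fract :: ("{idom, ring_char_0}") field_char_0
proof
  have "of_nat n = Fract (of_nat n :: 'a) 1" for n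
    by (induction n) (auto simp: Zero_fract_def One_fract_def)
  then show "inj (of_nat :: nat \<Rightarrow> 'a fract)"
    by (auto simp: inj_on_def eq_fract)
qed

lemma fract_indeterminate: "\<not> algebraic (Fract [:0, 1:] 1 :: int poly fract)"
proof
  let ?q = "Fract [:0, 1:] 1 :: int poly fract"
  assume "algebraic ?q"
  then obtain p where p: "\<And>i. coeff p i \<in> \<int>" "p \<noteq> 0" "poly p ?q = 0"
    by (auto simp: algebraic_def)
  have of_nat: "of_nat n = Fract (of_nat n :: int poly) 1" for n
    by (induction n) (auto simp: Zero_fract_def One_fract_def)
  have of_int: "of_int z = Fract (of_int z :: int poly) 1" for z
    by (cases z rule: int_cases2) (auto simp: of_nat)
  have eval: "\<exists>r :: int poly. p = map_poly of_int r \<and> poly p ?q = Fract r 1"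
    if "\<And>i. coeff p i \<in> \<int>" for p :: "int poly fract poly"
    using that
  proof (induction p)
    case 0
    then show ?case by (intro exI[of _ 0]) (simp add: Zero_fract_def)
  next
    case (pCons a p)
    have "coeff p i \<in> \<int>" for i
      using pCons.prems[of "Suc i"] by simp
    with pCons.IH obtain r :: "int poly" where r: "p = map_poly of_int r" "poly p ?q = Fract r 1"
      by blast
    obtain z where z: "a = of_int z"
      using pCons.prems[of 0] by (auto elim: Ints_cases)
    have "of_int z + [:0, 1:] * r = pCons z r"
      by (simp add: of_int_poly)
    then have "poly (pCons a p) ?q = Fract (pCons z r) 1"
      using r(2) z by (simp add: of_int)
    moreover have "pCons a p = map_poly of_int (pCons z r)"
      using r(1) z by (simp add: map_poly_pCons)
    ultimately show ?case by blast
  qed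
  obtain r :: "int poly" where "p = map_poly of_int r" "poly p ?q = Fract r 1"
    using eval p(1) by blast
  then show False
    using p(2,3) by (simp add: Zero_fract_def eq_fract)
qed

text \<open>
  For every indeterminate \<open>q\<close> there is a model: the tridiagonal matrices with entries
  \<open>D\<^sub>k\<^sub>,\<^sub>k = E\<^sub>k\<^sub>,\<^sub>k = [k + 1]\<close>, \<open>D\<^sub>k\<^sub>,\<^sub>k\<^sub>+\<^sub>1 = [k + 1] [k + 2]\<close> and \<open>E\<^sub>k\<^sub>+\<^sub>1\<^sub>,\<^sub>k = 1\<close>, where \<open>[k]\<close> is the \<open>q\<close>-analogue
  of \<open>k\<close>. A power series stands for the sequence of its coefficients.
\<close>

lemma matrix_ansatz_model:
  fixes q :: "'k::field_char_0"
  assumes "\<not> algebraic q"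
  shows "\<exists>D E W V. matrix_ansatz (\<lambda>c f. fps_const c * f :: 'k fps) q D E W V"
proof -
  define b where "b k = (\<Sum>i<k. q ^ i)" for k
  have b_Suc: "b (Suc k) = q * b k + 1" for k
    unfolding b_def by (subst sum.lessThan_Suc_shift) (simp add: sum_distrib_left)
  have b_0: "b 0 = 0"
    by (simp add: b_def)
  define D where "D f = Abs_fps (\<lambda>k. b (Suc k) * fps_nth f k + b (Suc k) * b (Suc (Suc k)) * fps_nth f (Suc k))"
    for f :: "'k fps"
  define E where "E f = Abs_fps (\<lambda>k. b (Suc k) * fps_nth f k + (if k = 0 then 0 else fps_nth f (k - 1)))"
    for f :: "'k fps"
  have "matrix_ansatz (\<lambda>c f. fps_const c * f :: 'k fps) q D E (\<lambda>f. fps_nth f 0) 1"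
  proof unfold_locales
    fix f :: "'k fps"
    have "fps_nth (D (E f) - fps_const q * E (D f)) k = fps_nth (D f + E f) k" for k
      by (cases k) (simp_all add: D_def E_def b_Suc b_0 algebra_simps)
    then show "D (E f) - fps_const q * E (D f) = D f + E f"
      by (simp only: fps_eq_iff) blast
  qed (use assms in \<open>auto simp: D_def E_def b_Suc b_0 fps_eq_iff algebra_simps\<close>)
  then show ?thesis by blast
qed

end

theory Submission
  imports Defs
begin

text \<open>
  Put \<open>d = (1 - q) D - 1\<close> and \<open>e = (1 - q) E - 1\<close>. Then \<open>d e - q e d = 1 - q\<close>, the scalar \<open>- q\<close> is
  the eigenvalue of \<open>e\<close> on \<open>W\<close> and of \<open>d\<close> on \<open>V\<close>, and \<open>(1 - q) (D + E) = x + 2\<close> with \<open>x = d + e\<close>.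

  Let \<open>U\<^sub>k\<close> be the Chebyshev polynomials with \<open>U\<^sub>-\<^sub>1 = 0\<close>, \<open>U\<^sub>0 = 1\<close> and \<open>x U\<^sub>k = U\<^sub>k\<^sub>-\<^sub>1 + U\<^sub>k\<^sub>+\<^sub>1\<close>.
  Multiplication by \<open>x + 2\<close> sends \<open>U\<^sub>k\<close> to \<open>U\<^sub>k\<^sub>-\<^sub>1 + 2 U\<^sub>k + U\<^sub>k\<^sub>+\<^sub>1\<close>, and the differences \<open>c(m, k)\<close> of binomial coefficients
  in the theorem satisfy the transposed recursion; so \<open>(x + 2)\<^sup>m\<close> is the sum of the \<open>c(m, k) U\<^sub>k\<close>
  (\<open>power_expansion\<close>).

  It remains to evaluate \<open>U\<^sub>k\<close> between \<open>W\<close> and \<open>V\<close>. Split \<open>U\<^sub>k\<close> into its parts \<open>P\<^sub>s\<^sub>,\<^sub>t\<close> of bidegree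
  \<open>(s, t)\<close>, \<open>s + t = k\<close>, where \<open>e\<close> counts as \<open>(1, 0)\<close>, \<open>d\<close> as \<open>(0, 1)\<close>, and
  the subtraction of \<open>U\<^sub>k\<^sub>-\<^sub>1\<close> in \<open>U\<^sub>k\<^sub>+\<^sub>1 = x U\<^sub>k - U\<^sub>k\<^sub>-\<^sub>1\<close> as \<open>(1, 1)\<close>. The defining recursion
  \<open>P\<^sub>s\<^sub>,\<^sub>t = e P\<^sub>s\<^sub>-\<^sub>1\<^sub>,\<^sub>t + d P\<^sub>s\<^sub>,\<^sub>t\<^sub>-\<^sub>1 - P\<^sub>s\<^sub>-\<^sub>1\<^sub>,\<^sub>t\<^sub>-\<^sub>1\<close> has a \<open>d\<close> on the left, where \<open>W\<close> cannot absorb it.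
  But \<open>d P\<^sub>s\<^sub>,\<^sub>t = q\<^sup>s P\<^sub>s\<^sub>,\<^sub>t d + (1 - q\<^sup>s) P\<^sub>s\<^sub>-\<^sub>1\<^sub>,\<^sub>t\<close>, which on \<open>V\<close> is \<open>d_part\<close> below, so an equivalent recursion has
  every \<open>d\<close> on the right, next to \<open>V\<close>. Between \<open>W\<close> and \<open>V\<close> it becomes a scalar recursion, solved
  in closed form by \<open>W_part\<close>. Summed over \<open>s + t = k\<close>, the closed form is a signed second
  difference of the sums in the theorem (\<open>W_chebyshev\<close>), and the recursion of \<open>c(m, k)\<close> moves this second difference
  onto the coefficients, turning \<open>c(m, k)\<close> into \<open>c(m + 1, k)\<close>.
\<close>

section \<open>Differences of binomial coefficients\<close>

definition ballot :: "nat \<Rightarrow> int \<Rightarrow> int" where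
  "ballot m k = int (binom (2 * m) (int m - k)) - int (binom (2 * m) (int m - k - 2))"

lemma binom_Suc: "binom (Suc a) b = binom a b + binom a (b - 1)"
proof (cases "b \<le> 0")
  case False
  then obtain c where "b = int (Suc c)"
    by (metis not0_implies_Suc not_le zero_le_imp_eq_int less_imp_le of_nat_0 order_refl)
  then show ?thesis by (simp add: binom_def nat_add_distrib)
qed (auto simp: binom_def)

lemma binom_symmetric: "binom a (int a - b) = binom a b"
proof -
  consider "b < 0" | "b > int a" | c where "b = int c" "c \<le> a"
    by (metis linorder_not_less of_nat_le_iff zero_le_imp_eq_int)
  then show ?thesis
  proof cases
    case 3
    then show ?thesis
      by (simp add: binom_def nat_diff_distrib binomial_symmetric[symmetric])
  qed (auto simp: binom_def binomial_eq_0 nat_diff_distrib)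
qed

text \<open>
  Pascal's rule used twice. The integer index makes this hold without a boundary case;
  \<open>ballot_minus_1\<close> and \<open>ballot_eq_0\<close> give the boundary values.
\<close>
lemma ballot_Suc: "ballot (Suc m) k = ballot m (k - 1) + 2 * ballot m k + ballot m (k + 1)"
proof -
  have "binom (2 * Suc m) b = binom (2 * m) b + 2 * binom (2 * m) (b - 1) + binom (2 * m) (b - 2)" for b
    by (simp add: binom_Suc)
  then show ?thesis
    by (simp add: ballot_def algebra_simps)
qed

text \<open>The reflection \<open>b \<mapsto> 2 m - b\<close> of the binomial coefficients exchanges the two terms at \<open>k = - 1\<close>.\<close>
lemma ballot_minus_1: "ballot m (- 1) = 0"
  using binom_symmetric[of "2 * m" "int m + 1"] by (simp add: ballot_def algebra_simps)

lemma ballot_eq_0: "k > int m \<Longrightarrow> ballot m k = 0"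
  by (simp add: ballot_def binom_def)

lemma ballot_0_0: "ballot 0 0 = 1"
  by (simp add: ballot_def binom_def)

context module
begin

text \<open>
  The operator \<open>a\<^sub>k \<mapsto> a\<^sub>k\<^sub>-\<^sub>1 + 2 a\<^sub>k + a\<^sub>k\<^sub>+\<^sub>1\<close> on sequences vanishing at \<open>-1\<close>
  is its own transpose, so it can be moved to the coefficients, where it raises \<open>m\<close> by
  \<open>ballot_Suc\<close>. The sequence is shifted by one, so that the term with index \<open>-1\<close> is \<open>a 0\<close>. The lemma is applied to vectors in \<open>power_expansion\<close> and to
  scalars in \<open>scaled_moment\<close>.
\<close>
lemma sum_ballot_Suc:
  assumes "a 0 = 0"
  shows "(\<Sum>k\<le>Suc m. of_int (ballot (Suc m) (int k)) *s a (Suc k)) =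
    (\<Sum>k\<le>m. of_int (ballot m (int k)) *s (a k + 2 *s a (Suc k) + a (Suc (Suc k))))"
proof -
  let ?c = "\<lambda>k. of_int (ballot m k)"
  have down: "(\<Sum>k\<le>Suc m. ?c (int k - 1) *s a (Suc k)) = (\<Sum>k\<le>m. ?c (int k) *s a (Suc (Suc k)))"
    by (subst sum.atMost_Suc_shift) (simp add: ballot_minus_1)
  have stay: "(\<Sum>k\<le>Suc m. ?c (int k) *s a (Suc k)) = (\<Sum>k\<le>m. ?c (int k) *s a (Suc k))"
    by (simp add: ballot_eq_0)
  have "(\<Sum>k\<le>Suc m. ?c (int k + 1) *s a (Suc k)) = (\<Sum>k\<le>Suc (Suc m). ?c (int k) *s a k)"
    by (subst (2) sum.atMost_Suc_shift) (simp add: assms add.commute)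
  then have up: "(\<Sum>k\<le>Suc m. ?c (int k + 1) *s a (Suc k)) = (\<Sum>k\<le>m. ?c (int k) *s a k)"
    by (simp add: ballot_eq_0)
  have "(\<Sum>k\<le>Suc m. of_int (ballot (Suc m) (int k)) *s a (Suc k)) =
      (\<Sum>k\<le>Suc m. ?c (int k - 1) *s a (Suc k)) + 2 *s (\<Sum>k\<le>Suc m. ?c (int k) *s a (Suc k))
        + (\<Sum>k\<le>Suc m. ?c (int k + 1) *s a (Suc k))"
    by (simp only: ballot_Suc of_int_add of_int_mult of_int_numeral scale_left_distrib
        sum.distrib scale_sum_right scale_scale)
  also have "\<dots> = (\<Sum>k\<le>m. of_int (ballot m (int k)) *s (a k + 2 *s a (Suc k) + a (Suc (Suc k))))"
    unfolding down stay up
    by (simp add: scale_right_distrib sum.distrib scale_sum_right mult.commute)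
  finally show ?thesis .
qed

end

section \<open>Sums of powers over an antidiagonal\<close>

text \<open>
  The sum of the \<open>q\<^sup>i\<^sup>j\<close> over \<open>i + j = k\<close>. The symmetry in \<open>i\<close> and \<open>j\<close> is lost in the sums of the
  theorem, where the summand for \<open>j = 0\<close>, which is \<open>1\<close>, is absent.
\<close>
definition antidiag_sum :: "'a::comm_ring_1 \<Rightarrow> nat \<Rightarrow> 'a" where
  "antidiag_sum q k = (\<Sum>i\<le>k. q ^ (i * (k - i)))"

lemma sum_power_eq_antidiag_sum: "(\<Sum>i = 0..k. q ^ (i * (k + 1 - i))) = antidiag_sum q (Suc k) - 1"
  by (simp add: antidiag_sum_def atMost_atLeast0)

text \<open>
  The four terms on the right are \<open>q ^ (s t)\<close>, \<open>q ^ (s (t + 1))\<close>, \<open>q ^ ((s + 1) t)\<close> and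
  \<open>q ^ ((s + 1) (t + 1))\<close> with \<open>s = i\<close> and \<open>t = k - i\<close>, up to sign. Each runs through
  an antidiagonal from which the summands on the axes may be missing: none, one, one and two of them. They are all \<open>1\<close> and cancel.
\<close>
lemma antidiag_sum_second_difference:
  "2 * antidiag_sum q (Suc k) - antidiag_sum q k - antidiag_sum q (Suc (Suc k)) =
    - (\<Sum>i\<le>k. q ^ (i * (k - i)) * (1 - q ^ i - q ^ (k - i) + q ^ (k + 1)))"
proof -
  have right: "antidiag_sum q (Suc k) - 1 = (\<Sum>i\<le>k. q ^ (i * (k - i)) * q ^ i)"
    unfolding antidiag_sum_def by (simp add: Suc_diff_le power_add[symmetric] add.commute)
  have left: "antidiag_sum q (Suc k) - 1 = (\<Sum>i\<le>k. q ^ (i * (k - i)) * q ^ (k - i))"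
    unfolding antidiag_sum_def
    by (subst sum.atMost_Suc_shift) (simp add: power_add[symmetric] add.commute)
  have "antidiag_sum q (Suc (Suc k)) - 2 = (\<Sum>i\<le>k. q ^ (Suc i * (Suc k - i)))"
    unfolding antidiag_sum_def by (subst sum.atMost_Suc_shift) simp
  also have "\<dots> = (\<Sum>i\<le>k. q ^ (i * (k - i)) * q ^ (k + 1))"
  proof (rule sum.cong)
    fix i assume "i \<in> {..k}"
    then have "Suc i * (Suc k - i) = i * (k - i) + (k + 1)"
      by (auto simp: Suc_diff_le)
    then show "q ^ (Suc i * (Suc k - i)) = q ^ (i * (k - i)) * q ^ (k + 1)"
      by (simp only: power_add)
  qed simp
  finally have both: "antidiag_sum q (Suc (Suc k)) - 2 = (\<Sum>i\<le>k. q ^ (i * (k - i)) * q ^ (k + 1))" .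
  have "(\<Sum>i\<le>k. q ^ (i * (k - i)) * (1 - q ^ i - q ^ (k - i) + q ^ (k + 1))) =
      antidiag_sum q k - (antidiag_sum q (Suc k) - 1) - (antidiag_sum q (Suc k) - 1)
        + (antidiag_sum q (Suc (Suc k)) - 2)"
    unfolding both by (subst right, subst left)
      (simp add: antidiag_sum_def algebra_simps sum.distrib sum_subtractf)
  then show ?thesis by (simp add: algebra_simps)
qed

section \<open>The Chebyshev vectors and their bihomogeneous parts\<close>

context matrix_ansatz
begin

text \<open>
  Shifting and rescaling removes the linear terms from the commutation relation (see \<open>d_e\<close>).
\<close>
definition d :: "'v \<Rightarrow> 'v" where "d v = (1 - q) *s D v - v"

definition e :: "'v \<Rightarrow> 'v" where "e v = (1 - q) *s E v - v"

sublocale D: Vector_Spaces.linear scale scale D by (rule linear_D)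
sublocale E: Vector_Spaces.linear scale scale E by (rule linear_E)

lemma W_linear:
  "W 0 = 0" "W (x + y) = W x + W y" "W (x - y) = W x - W y" "W (c *s x) = c * W x"
  "W (sum f S) = (\<Sum>s\<in>S. W (f s))"
proof -
  interpret W: Vector_Spaces.linear scale "(*)" W by (rule linear_W)
  show "W 0 = 0" "W (x + y) = W x + W y" "W (x - y) = W x - W y" "W (c *s x) = c * W x"
    "W (sum f S) = (\<Sum>s\<in>S. W (f s))"
    by (fact W.zero W.add W.diff W.scale W.sum)+
qed

lemma d_linear [simp]:
  "d 0 = 0" "d (x + y) = d x + d y" "d (x - y) = d x - d y" "d (- x) = - d x"
  "d (c *s x) = c *s d x"
  by (simp_all add: d_def D.zero D.add D.diff D.neg D.scale algebra_simps)

lemma e_linear [simp]: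
  "e 0 = 0" "e (x + y) = e x + e y" "e (x - y) = e x - e y" "e (c *s x) = c *s e x"
  by (simp_all add: e_def E.zero E.add E.diff E.scale algebra_simps)

lemma d_e: "d (e v) = q *s e (d v) + (1 - q) *s v"
proof -
  have DE: "D (E v) = q *s E (D v) + D v + E v"
    using commutation[of v] by (simp add: algebra_simps)
  show ?thesis
    unfolding d_def e_def D.diff E.diff D.scale E.scale DE by (simp add: algebra_simps)
qed

lemma d_V: "d V = - q *s V"
  by (simp add: d_def D_V algebra_simps)

lemma W_e: "W (e v) = - q * W v"
  by (simp add: e_def W_linear W_E algebra_simps)

text \<open>
  \<open>part (s + 1) (t + 1)\<close> is the vector \<open>P\<^sub>s\<^sub>,\<^sub>t V\<close>; the offset makes room for the zero boundary
  values at index \<open>-1\<close>. The recursion is the one with \<open>d\<close> moved to \<open>V\<close>, where it acts as \<open>- q\<close>: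
  \<open>P\<^sub>s\<^sub>,\<^sub>t = e P\<^sub>s\<^sub>-\<^sub>1\<^sub>,\<^sub>t + q\<^sup>s P\<^sub>s\<^sub>,\<^sub>t\<^sub>-\<^sub>1 d - q\<^sup>s P\<^sub>s\<^sub>-\<^sub>1\<^sub>,\<^sub>t\<^sub>-\<^sub>1\<close>.
\<close>
fun part :: "nat \<Rightarrow> nat \<Rightarrow> 'v" where
  "part 0 t = 0"
| "part (Suc s) 0 = 0"
| "part (Suc s) (Suc t) = (if s = 0 \<and> t = 0 then V
    else e (part s (Suc t)) - q ^ Suc s *s part (Suc s) t - q ^ s *s part s t)"

lemma part_0_right [simp]: "part s 0 = 0"
  by (cases s) simp_all

text \<open>
  The relation \<open>d P\<^sub>s\<^sub>,\<^sub>t = q\<^sup>s P\<^sub>s\<^sub>,\<^sub>t d + (1 - q\<^sup>s) P\<^sub>s\<^sub>-\<^sub>1\<^sub>,\<^sub>t\<close>, applied to \<open>V\<close>. In the induction \<open>d\<close> passes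
  the leading \<open>e\<close> by \<open>d_e\<close>, and what remains is a multiple of the recursion for \<open>P\<^sub>s\<^sub>-\<^sub>1\<^sub>,\<^sub>t\<close>.
\<close>
lemma d_part: "d (part (Suc s) t) = (1 - q ^ s) *s part s t - q ^ Suc s *s part (Suc s) t"
proof (induction s arbitrary: t)
  case 0
  show ?case
    by (induction t) (auto simp: d_V)
next
  case (Suc r)
  note IHr = Suc.IH
  show ?case
  proof (induction t)
    case (Suc t)
    define p where "p = q ^ r"
    (* The linear combination behind the induction step, for arbitrary vectors in place of the parts. *)
    have collect: "q *s ((1 - p) *s (X + (q * p) *s Z + p *s Q) - (q * p) *s Y) + (1 - q) *s X
        - (q * (q * p)) *s ((1 - q * p) *s Z - (q * (q * p)) *s U)
        - (q * p) *s ((1 - p) *s Q - (q * p) *s Z) =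
      (1 - q * p) *s X - (q * (q * p)) *s (Y - (q * (q * p)) *s U - (q * p) *s Z)" for X Y Z Q U
      by (simp add: algebra_simps)
    (* The recursion for part (Suc r) (Suc t), solved for its first term. It fails at the corner
       r = t = 0, where the factor 1 - q ^ r vanishes. *)
    have e_part: "(1 - q ^ r) *s e (part r (Suc t)) =
        (1 - q ^ r) *s (part (Suc r) (Suc t) + q ^ Suc r *s part (Suc r) t + q ^ r *s part r t)"
      by (cases "r = 0") auto
    have part_Suc: "part (Suc (Suc r)) (Suc t) =
        e (part (Suc r) (Suc t)) - q ^ Suc (Suc r) *s part (Suc (Suc r)) t - q ^ Suc r *s part (Suc r) t"
      by simp
    have "d (part (Suc (Suc r)) (Suc t)) =
        q *s e (d (part (Suc r) (Suc t))) + (1 - q) *s part (Suc r) (Suc t)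
        - q ^ Suc (Suc r) *s d (part (Suc (Suc r)) t) - q ^ Suc r *s d (part (Suc r) t)"
      by (simp only: part_Suc d_linear d_e)
    also have "\<dots> = (1 - q ^ Suc r) *s part (Suc r) (Suc t) - q ^ Suc (Suc r) *s part (Suc (Suc r)) (Suc t)"
      unfolding IHr Suc.IH e_linear e_part
      unfolding part_Suc power_Suc p_def[symmetric] by (rule collect)
    finally show ?case .
  qed simp
qed

text \<open>
  By \<open>d_part\<close>, moving \<open>d\<close> back to the left turns the recursion that defines the parts into the
  bidegree \<open>(s, t)\<close> part of \<open>U\<^sub>k = (d + e) U\<^sub>k\<^sub>-\<^sub>1 - U\<^sub>k\<^sub>-\<^sub>2\<close>. This identifies the antidiagonal sums of
  the parts as Chebyshev vectors.
\<close>
lemma part_step: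
  assumes "s \<noteq> 0 \<or> t \<noteq> 0"
  shows "part (Suc s) (Suc t) = e (part s (Suc t)) + d (part (Suc s) t) - part s t"
  using assms by (auto simp: d_part algebra_simps)

text \<open>
  \<open>chebyshev (k + 1)\<close> is \<open>U\<^sub>k V\<close>, and \<open>chebyshev 0\<close> stands for \<open>U\<^sub>-\<^sub>1 V = 0\<close>. The sum includes the zero
  boundary values of the parts, which lets \<open>chebyshev_rec\<close> hold without a case distinction.
\<close>
definition chebyshev :: "nat \<Rightarrow> 'v" where
  "chebyshev k = (\<Sum>s\<le>Suc k. part s (Suc k - s))"

lemma chebyshev_0: "chebyshev 0 = 0"
  by (simp add: chebyshev_def)

lemma chebyshev_Suc: "chebyshev (Suc k) = (\<Sum>s\<le>k. part (Suc s) (Suc (k - s)))"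
proof -
  have "chebyshev (Suc k) = (\<Sum>s\<le>Suc k. part (Suc s) (Suc k - s))"
    unfolding chebyshev_def by (subst sum.atMost_Suc_shift) simp
  then show ?thesis by (simp add: Suc_diff_le)
qed

lemma chebyshev_1: "chebyshev 1 = V"
  by (simp add: chebyshev_Suc)

lemma d_sum: "d (sum f S) = (\<Sum>s\<in>S. d (f s))"
  by (induction S rule: infinite_finite_induct) simp_all

lemma e_sum: "e (sum f S) = (\<Sum>s\<in>S. e (f s))"
  by (induction S rule: infinite_finite_induct) simp_all

lemma chebyshev_rec:
  "d (chebyshev (Suc k)) + e (chebyshev (Suc k)) = chebyshev k + chebyshev (Suc (Suc k))"
proof -
  have "chebyshev (Suc (Suc k)) =
      (\<Sum>s\<le>Suc k. e (part s (Suc (Suc k - s))) + d (part (Suc s) (Suc k - s)) - part s (Suc k - s))"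
    unfolding chebyshev_Suc by (intro sum.cong part_step) auto
  also have "\<dots> = (\<Sum>s\<le>Suc k. e (part s (Suc (Suc k - s)))) + (\<Sum>s\<le>Suc k. d (part (Suc s) (Suc k - s)))
      - chebyshev k"
    by (simp only: sum.distrib sum_subtractf chebyshev_def)
  also have "(\<Sum>s\<le>Suc k. e (part s (Suc (Suc k - s)))) = e (chebyshev (Suc k))"
    unfolding chebyshev_Suc e_sum by (subst sum.atMost_Suc_shift) simp
  also have "(\<Sum>s\<le>Suc k. d (part (Suc s) (Suc k - s))) = d (chebyshev (Suc k))"
    unfolding chebyshev_Suc d_sum by (simp add: Suc_diff_le)
  finally show ?thesis by simp
qed

text \<open>
  Since \<open>(1 - q) (D + E) = d + e + 2\<close>, this is the expansion of \<open>(x + 2)\<^sup>m\<close> in Chebyshev polynomials.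
\<close>
lemma power_expansion:
  "(1 - q) ^ m *s ((\<lambda>v. D v + E v) ^^ m) V = (\<Sum>k\<le>m. of_int (ballot m (int k)) *s chebyshev (Suc k))"
proof (induction m)
  case 0
  show ?case by (simp add: ballot_0_0 chebyshev_1[simplified])
next
  case (Suc m)
  let ?X = "\<lambda>v. D v + E v"
  have X: "(1 - q) *s ?X v = d v + e v + 2 *s v" for v
    using scale_left_distrib[of 1 1 v] by (simp add: d_def e_def algebra_simps)
  have "(1 - q) ^ Suc m *s (?X ^^ Suc m) V = (1 - q) *s ?X ((1 - q) ^ m *s (?X ^^ m) V)"
    by (simp add: D.scale E.scale scale_right_distrib mult_ac)
  also have "\<dots> = (\<Sum>k\<le>m. of_int (ballot m (int k)) *s
      (d (chebyshev (Suc k)) + e (chebyshev (Suc k)) + 2 *s chebyshev (Suc k)))"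
    unfolding Suc.IH X
    by (simp add: d_sum e_sum scale_right_distrib sum.distrib scale_sum_right mult.commute)
  also have "\<dots> = (\<Sum>k\<le>Suc m. of_int (ballot (Suc m) (int k)) *s chebyshev (Suc k))"
    unfolding chebyshev_rec sum_ballot_Suc[of chebyshev, OF chebyshev_0]
    by (simp add: add_ac)
  finally show ?case .
qed

section \<open>Evaluation of the moments\<close>

lemma W_part_Suc:
  assumes "s \<noteq> 0 \<or> t \<noteq> 0"
  shows "W (part (Suc s) (Suc t)) = - q * W (part s (Suc t)) - q ^ Suc s * W (part (Suc s) t) - q ^ s * W (part s t)"
  using assms by (auto simp: W_linear W_e)

text \<open>
  With \<open>w\<close> the left-hand side at \<open>(s, t)\<close>, the recursion reads
  \<open>w\<^sub>s\<^sub>,\<^sub>t = - q w\<^sub>s\<^sub>-\<^sub>1\<^sub>,\<^sub>t - q\<^sup>s\<^sup>+\<^sup>1 w\<^sub>s\<^sub>,\<^sub>t\<^sub>-\<^sub>1 - q\<^sup>s w\<^sub>s\<^sub>-\<^sub>1\<^sub>,\<^sub>t\<^sub>-\<^sub>1\<close>, and the right-hand side satisfies it as well. On the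
  axes both sides are \<open>(1 - q) (- q)\<^sup>s\<^sup>+\<^sup>t\<close>.
\<close>
lemma W_part:
  "(1 - q) * W (part (Suc s) (Suc t)) =
    - ((- 1) ^ (s + t) * q ^ (s * t) * (1 - q ^ s - q ^ t + q ^ (s + t + 1)))"
proof (induction s arbitrary: t)
  case 0
  show ?case
  proof (induction t)
    case (Suc t)
    have step: "(1 - q) * W (part (Suc 0) (Suc (Suc t))) = - q * ((1 - q) * W (part (Suc 0) (Suc t)))"
      by (simp add: W_part_Suc W_linear del: part.simps(3))
    show ?case unfolding step Suc.IH by (simp add: algebra_simps)
  qed (simp add: W_V)
next
  case (Suc r)
  note IHr = Suc.IH
  show ?case
  proof (induction t)
    case 0
    have step: "(1 - q) * W (part (Suc (Suc r)) (Suc 0)) = - q * ((1 - q) * W (part (Suc r) (Suc 0)))"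
      by (simp add: W_part_Suc W_linear del: part.simps(3))
    show ?case unfolding step IHr by (simp add: algebra_simps)
  next
    case (Suc t)
    have step: "(1 - q) * W (part (Suc (Suc r)) (Suc (Suc t))) =
        - q * ((1 - q) * W (part (Suc r) (Suc (Suc t))))
        - q ^ Suc (Suc r) * ((1 - q) * W (part (Suc (Suc r)) (Suc t)))
        - q ^ Suc r * ((1 - q) * W (part (Suc r) (Suc t)))"
      by (simp add: W_part_Suc[of "Suc r" "Suc t"] right_diff_distrib mult.left_commute[of "1 - q"] del: part.simps(3))
    show ?case
      unfolding step IHr Suc.IH by (simp add: power_add algebra_simps)
  qed
qed

lemma W_chebyshev:
  "(1 - q) * W (chebyshev (Suc k)) =
    (- 1) ^ k * (2 * antidiag_sum q (Suc k) - antidiag_sum q k - antidiag_sum q (Suc (Suc k)))"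
proof -
  have "(1 - q) * W (chebyshev (Suc k)) = (\<Sum>s\<le>k. (1 - q) * W (part (Suc s) (Suc (k - s))))"
    by (simp only: chebyshev_Suc W_linear sum_distrib_left)
  also have "\<dots> = (\<Sum>s\<le>k. (- 1) ^ k * - (q ^ (s * (k - s)) * (1 - q ^ s - q ^ (k - s) + q ^ (k + 1))))"
    by (intro sum.cong) (simp_all only: W_part, simp)
  finally show ?thesis
    by (simp only: antidiag_sum_second_difference sum_distrib_left[symmetric] sum_negf)
qed

lemma q_neq_1: "q \<noteq> 1"
proof
  assume "q = 1"
  then have "algebraic q"
    by (intro algebraicI[of "[:-1, 1:]"]) (auto simp: coeff_pCons split: nat.splits)
  then show False using indeterminate by blast
qed

lemma module_times: "module ((*) :: 'k \<Rightarrow> 'k \<Rightarrow> 'k)"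
  by unfold_locales (simp_all add: algebra_simps)

text \<open>
  One factor \<open>1 - q\<close> beyond those of \<open>power_expansion\<close> is spent on \<open>W_chebyshev\<close>. That lemma gives
  the value of each Chebyshev vector as \<open>a\<^sub>k + 2 a\<^sub>k\<^sub>+\<^sub>1 + a\<^sub>k\<^sub>+\<^sub>2\<close>: the alternating sign of \<open>a\<close> turns the
  second difference into this form, and the constant \<open>1\<close> in \<open>a\<close>, which drops out of it, makes
  \<open>a\<^sub>0 = 0\<close>.
\<close>
lemma scaled_moment:
  "(1 - q) ^ Suc m * W (((\<lambda>v. D v + E v) ^^ m) V) =
    (\<Sum>k\<le>Suc m. of_int (ballot (Suc m) (int k)) * ((- 1) ^ k * (antidiag_sum q (Suc k) - 1)))"
proof -
  define a where "a k = (- 1) ^ k * (1 - antidiag_sum q k)" for k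
  have "(1 - q) ^ Suc m * W (((\<lambda>v. D v + E v) ^^ m) V) =
      (1 - q) * W ((1 - q) ^ m *s ((\<lambda>v. D v + E v) ^^ m) V)"
    by (simp add: W_linear)
  also have "\<dots> = (\<Sum>k\<le>m. of_int (ballot m (int k)) * ((1 - q) * W (chebyshev (Suc k))))"
    by (simp add: power_expansion W_linear sum_distrib_left mult_ac)
  also have "\<dots> = (\<Sum>k\<le>m. of_int (ballot m (int k)) * (a k + 2 * a (Suc k) + a (Suc (Suc k))))"
    unfolding W_chebyshev a_def by (simp add: algebra_simps)
  also have "\<dots> = (\<Sum>k\<le>Suc m. of_int (ballot (Suc m) (int k)) * a (Suc k))"
    by (rule module.sum_ballot_Suc[symmetric, OF module_times]) (simp add: a_def antidiag_sum_def)
  finally show ?thesis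
    by (simp only: a_def) (simp add: algebra_simps)
qed

end

theorem theorem2:
  fixes scale :: "'k::field_char_0 \<Rightarrow> 'v::ab_group_add \<Rightarrow> 'v"
    and q :: 'k
    and D E :: "'v \<Rightarrow> 'v"
    and W :: "'v \<Rightarrow> 'k"
    and V :: 'v
    and n :: nat
  assumes "matrix_ansatz scale q D E W V"
    and "n > 0"
  shows "W (((\<lambda>v. D v + E v) ^^ (n - 1)) V) =
    1 / (1 - q) ^ n *
    (\<Sum>k = 0..n. (- 1) ^ k *
      (of_nat (binom (2 * n) (int n - int k)) - of_nat (binom (2 * n) (int n - int k - 2))) *
      (\<Sum>i = 0..k. q ^ (i * (k + 1 - i))))"
proof -
  interpret matrix_ansatz scale q D E W V by fact
  obtain m where n: "n = Suc m"
    using \<open>n > 0\<close> by (cases n) auto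
  have "of_int (ballot n (int k)) =
      (of_nat (binom (2 * n) (int n - int k)) - of_nat (binom (2 * n) (int n - int k - 2)) :: 'k)" for k
    by (simp add: ballot_def)
  then have "(\<Sum>k = 0..n. (- 1) ^ k *
      (of_nat (binom (2 * n) (int n - int k)) - of_nat (binom (2 * n) (int n - int k - 2))) *
      (\<Sum>i = 0..k. q ^ (i * (k + 1 - i)))) =
      (\<Sum>k\<le>n. of_int (ballot n (int k)) * ((- 1) ^ k * (antidiag_sum q (Suc k) - 1)))"
    unfolding sum_power_eq_antidiag_sum atMost_atLeast0 by (intro sum.cong) (simp_all add: mult_ac)
  also have "\<dots> = (1 - q) ^ n * W (((\<lambda>v. D v + E v) ^^ (n - 1)) V)"
    unfolding n using scaled_moment[of m] by (simp only: diff_Suc_1)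
  finally show ?thesis
    using q_neq_1 by simp
qed

end
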